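(* Let $(P_t)_{t\ge 0}$ be the semigroup of a Markov process with state space $E$ and with invariant distribution $\pi$. Assume that: (i) the Wasserstein curvature $\rho$ of $(P_t)_{t\ge0}$ is positive; (ii) the semigroup is reversible (with respect to $\pi$); (iii) $\lim_{t\to 0}\|P_tf-f\|_{L^2(\pi)}=0$ for all $f\in L^2(\pi)$; (iv) $\mathrm{Lip}_1\cap L^\infty(\pi)\cap L^2(\pi)$ is dense in $L^2(\pi)$. Then $(P_t)_{t\ge0}$ admits an invariant distribution $\pi$ and, for all $f\in L^2(\pi)$ and all $t\ge 0$, $$\mathrm{Var}_\pi(P_tf)\le e^{-2\rho t}\,\mathrm{Var}_\pi(f).$$
   Context: $E\subset\mathbb{R}$ is an interval with the distance $|x-y|$, and $P_tg(x)=\mathbb{E}[g(X_t)\mid X_0=x]$ for the Markov process $(X_t)_{t\ge0}$. $\mathrm{Lip}_1$ is the set of functions $g:E\to\mathbb{R}$ with $|g(x)-g(y)|\le|x-y|$ for all $x,y\in E$. The Wasserstein curvature of the process (or of its semigroup) is the optimal (largest) constant $\rho\in\mathbb{R}$ such that $$\sup_{x,y\in E,\,x\ne y}\frac{|P_tg(x)-P_tg(y)|}{|x-y|}\le e^{-\rho t}\quad\text{for all } g\in\mathrm{Lip}_1,\ t\ge0.$$ $\mathrm{Var}_\pi(f)=\int_E\left(f-\int_E f\,d\pi\right)^2d\pi=\left\|f-\int f\,d\pi\right\|_{L^2(\pi)}^2$. *)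

theory Defs
  imports "HOL-Probability.Probability"
begin

abbreviation borel_on :: "real set \<Rightarrow> real measure" where
  "borel_on E \<equiv> restrict_space borel E"

definition natural_filtration ::
    "real set \<Rightarrow> 'w measure \<Rightarrow> (real \<Rightarrow> 'w \<Rightarrow> real) \<Rightarrow> real \<Rightarrow> 'w measure" where
  "natural_filtration E \<Omega> X s =
     sigma (space \<Omega>) (\<Union>u\<in>{0..s}. {X u -` A \<inter> space \<Omega> |A. A \<in> sets (borel_on E)})"

text \<open>
  A time-homogeneous Markov process with state space \<open>E\<close>: \<open>\<Omega>\<close> is the sample space (only its
  \<open>\<sigma>\<close>-algebra is used) and \<open>Pr x\<close> is the law of the process started from \<open>x\<close>, i.e. the
  conditional probability given \<open>X 0 = x\<close>.  The Markov property is with respect to the natural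
  filtration.
\<close>

locale markov_process =
  fixes E :: "real set" and \<Omega> :: "'w measure"
    and Pr :: "real \<Rightarrow> 'w measure" and X :: "real \<Rightarrow> 'w \<Rightarrow> real"
  assumes interval: "is_interval E"
    and prob: "x \<in> E \<Longrightarrow> prob_space (Pr x)"
    and sets_Pr: "x \<in> E \<Longrightarrow> sets (Pr x) = sets \<Omega>"
    and measurable_X: "0 \<le> t \<Longrightarrow> X t \<in> measurable \<Omega> (borel_on E)"
    and start: "x \<in> E \<Longrightarrow> AE \<omega> in Pr x. X 0 \<omega> = x"
    and measurable_transition: "\<lbrakk>0 \<le> t; A \<in> sets (borel_on E)\<rbrakk> \<Longrightarrow>
      (\<lambda>x. measure (Pr x) (X t -` A \<inter> space \<Omega>)) \<in> borel_measurable (borel_on E)"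
    and markov: "\<lbrakk>x \<in> E; 0 \<le> s; 0 \<le> t; A \<in> sets (borel_on E)\<rbrakk> \<Longrightarrow>
      AE \<omega> in Pr x.
        real_cond_exp (Pr x) (natural_filtration E \<Omega> X s) (\<lambda>\<omega>. indicator A (X (s + t) \<omega>)) \<omega>
          = measure (Pr (X s \<omega>)) (X t -` A \<inter> space \<Omega>)"

definition semigroup_of ::
    "(real \<Rightarrow> 'w measure) \<Rightarrow> (real \<Rightarrow> 'w \<Rightarrow> real) \<Rightarrow> real \<Rightarrow> (real \<Rightarrow> real) \<Rightarrow> real \<Rightarrow> real" where
  "semigroup_of Pr X t g x = (\<integral>\<omega>. g (X t \<omega>) \<partial>Pr x)"

definition Lip1 :: "real set \<Rightarrow> (real \<Rightarrow> real) set" where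
  "Lip1 E = {g. \<forall>x\<in>E. \<forall>y\<in>E. \<bar>g x - g y\<bar> \<le> \<bar>x - y\<bar>}"

text \<open>
  The supremum is taken in the extended reals, since a real supremum of an unbounded set is
  unspecified.  Integrability of \<open>g (X t)\<close> is part of the definition: the Bochner integral of a
  non-integrable function is \<open>0\<close>, which would make the contraction estimate hold spuriously.
\<close>

definition contracts_Lip1 ::
    "real set \<Rightarrow> (real \<Rightarrow> 'w measure) \<Rightarrow> (real \<Rightarrow> 'w \<Rightarrow> real) \<Rightarrow> real \<Rightarrow> bool" where
  "contracts_Lip1 E Pr X r \<longleftrightarrow>
     (\<forall>g\<in>Lip1 E. \<forall>t\<ge>0.
        (\<forall>x\<in>E. integrable (Pr x) (\<lambda>\<omega>. g (X t \<omega>))) \<and>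
        (SUP (x, y) \<in> {(x, y). x \<in> E \<and> y \<in> E \<and> x \<noteq> y}.
           ereal (\<bar>semigroup_of Pr X t g x - semigroup_of Pr X t g y\<bar> / \<bar>x - y\<bar>))
          \<le> ereal (exp (- r * t)))"

definition is_wasserstein_curvature ::
    "real set \<Rightarrow> (real \<Rightarrow> 'w measure) \<Rightarrow> (real \<Rightarrow> 'w \<Rightarrow> real) \<Rightarrow> real \<Rightarrow> bool" where
  "is_wasserstein_curvature E Pr X \<rho> \<longleftrightarrow>
     contracts_Lip1 E Pr X \<rho> \<and> (\<forall>r. contracts_Lip1 E Pr X r \<longrightarrow> r \<le> \<rho>)"

definition invariant_distribution ::
    "real set \<Rightarrow> (real \<Rightarrow> 'w measure) \<Rightarrow> (real \<Rightarrow> 'w \<Rightarrow> real) \<Rightarrow> real measure \<Rightarrow> bool" where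
  "invariant_distribution E Pr X \<pi> \<longleftrightarrow>
     prob_space \<pi> \<and> sets \<pi> = sets (borel_on E) \<and>
     (\<forall>t\<ge>0. \<forall>A\<in>sets (borel_on E). (\<integral>x. semigroup_of Pr X t (indicator A) x \<partial>\<pi>) = measure \<pi> A)"

text \<open>
  Elements of \<open>L\<^sup>2(\<pi>)\<close> and \<open>L\<^sup>\<infinity>(\<pi>)\<close> are represented by functions rather than by classes modulo
  \<open>\<pi>\<close>-null sets; everything below depends only on the class when \<open>\<pi>\<close> is invariant.
\<close>

definition L2 :: "real measure \<Rightarrow> (real \<Rightarrow> real) set" where
  "L2 \<pi> = {f \<in> borel_measurable \<pi>. integrable \<pi> (\<lambda>x. (f x)\<^sup>2)}"

definition Linf :: "real measure \<Rightarrow> (real \<Rightarrow> real) set" where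
  "Linf \<pi> = {f \<in> borel_measurable \<pi>. \<exists>C. AE x in \<pi>. \<bar>f x\<bar> \<le> C}"

definition L2_norm :: "real measure \<Rightarrow> (real \<Rightarrow> real) \<Rightarrow> real" where
  "L2_norm \<pi> f = sqrt (\<integral>x. (f x)\<^sup>2 \<partial>\<pi>)"

definition L2_dense :: "real measure \<Rightarrow> (real \<Rightarrow> real) set \<Rightarrow> bool" where
  "L2_dense \<pi> D \<longleftrightarrow> (\<forall>f\<in>L2 \<pi>. \<forall>e>0. \<exists>g\<in>D. L2_norm \<pi> (\<lambda>x. f x - g x) < e)"

definition Var :: "real measure \<Rightarrow> (real \<Rightarrow> real) \<Rightarrow> real" where
  "Var \<pi> f = (\<integral>x. (f x - (\<integral>y. f y \<partial>\<pi>))\<^sup>2 \<partial>\<pi>)"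

definition reversible ::
    "(real \<Rightarrow> 'w measure) \<Rightarrow> (real \<Rightarrow> 'w \<Rightarrow> real) \<Rightarrow> real measure \<Rightarrow> bool" where
  "reversible Pr X \<pi> \<longleftrightarrow>
     (\<forall>t\<ge>0. \<forall>f\<in>L2 \<pi>. \<forall>g\<in>L2 \<pi>.
        (\<integral>x. f x * semigroup_of Pr X t g x \<partial>\<pi>) = (\<integral>x. semigroup_of Pr X t f x * g x \<partial>\<pi>))"

text \<open>
  The set \<open>Lip1 E \<inter> Linf \<pi> \<inter> L2 \<pi>\<close>, with Lipschitz constant at most one, is dense in \<open>L\<^sup>2(\<pi>)\<close>
  only if every \<open>f \<in> L\<^sup>2(\<pi>)\<close> is constant a.e. (\<open>Lip1_dense_degenerate\<close>).  Density is therefore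
  understood up to scaling, i.e. for the linear span, which consists of the functions
  \<open>\<lambda>x. c * g x\<close> with \<open>g\<close> in that set.  The literal property implies the scaled one
  (\<open>Lip1_dense_imp_scaled\<close>).
\<close>

lemma Lip1_dense_imp_scaled:
  assumes "L2_dense \<pi> (Lip1 E \<inter> Linf \<pi> \<inter> L2 \<pi>)"
  shows "L2_dense \<pi> {\<lambda>x. c * g x |c g. g \<in> Lip1 E \<inter> Linf \<pi> \<inter> L2 \<pi>}"
proof -
  have "Lip1 E \<inter> Linf \<pi> \<inter> L2 \<pi> \<subseteq> {\<lambda>x. c * g x |c g. g \<in> Lip1 E \<inter> Linf \<pi> \<inter> L2 \<pi>}"
  proof
    fix g assume "g \<in> Lip1 E \<inter> Linf \<pi> \<inter> L2 \<pi>"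
    then show "g \<in> {\<lambda>x. c * g x |c g. g \<in> Lip1 E \<inter> Linf \<pi> \<inter> L2 \<pi>}"
      by (intro CollectI exI[of _ 1] exI[of _ g]) auto
  qed
  then show ?thesis using assms unfolding L2_dense_def by (meson subsetD)
qed

lemma L2_diff:
  assumes "f \<in> L2 \<pi>" "g \<in> L2 \<pi>"
  shows "(\<lambda>x. f x - g x) \<in> L2 \<pi>"
proof -
  have [measurable]: "f \<in> borel_measurable \<pi>" "g \<in> borel_measurable \<pi>"
    using assms by (auto simp: L2_def)
  have i: "integrable \<pi> (\<lambda>x. 2 * (f x)\<^sup>2 + 2 * (g x)\<^sup>2)"
    using assms by (auto simp: L2_def)
  have "norm ((f x - g x)\<^sup>2) \<le> norm (2 * (f x)\<^sup>2 + 2 * (g x)\<^sup>2)" for x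
  proof -
    have "2 * (f x)\<^sup>2 + 2 * (g x)\<^sup>2 = (f x - g x)\<^sup>2 + (f x + g x)\<^sup>2"
      by (simp add: power2_eq_square algebra_simps)
    then show ?thesis by simp
  qed
  then have "integrable \<pi> (\<lambda>x. (f x - g x)\<^sup>2)"
    by (intro Bochner_Integration.integrable_bound[OF i]) auto
  then show ?thesis by (simp add: L2_def)
qed

lemma Lip1_dense_degenerate:
  assumes inv: "invariant_distribution E Pr X \<pi>"
    and dense: "L2_dense \<pi> (Lip1 E \<inter> Linf \<pi> \<inter> L2 \<pi>)"
    and f: "f \<in> L2 \<pi>"
  shows "\<exists>c. AE x in \<pi>. f x = c"
proof -
  interpret prob_space \<pi> using inv by (simp add: invariant_distribution_def)
  have sp: "space \<pi> = E"
    using inv sets_eq_imp_space_eq[of \<pi> "borel_on E"]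
    by (simp add: invariant_distribution_def space_restrict_space)
  have "\<exists>g. g \<in> Lip1 E \<and> g \<in> L2 \<pi> \<and> L2_norm \<pi> (\<lambda>x. real (Suc n) * f x - g x) < 1" for n
  proof -
    have "(\<lambda>x. real (Suc n) * f x) \<in> L2 \<pi>"
      using f by (auto simp: L2_def power_mult_distrib simp del: of_nat_Suc)
    then show ?thesis
      using dense[unfolded L2_dense_def, rule_format, of "\<lambda>x. real (Suc n) * f x" 1] by auto
  qed
  then obtain g where g: "\<And>n. g n \<in> Lip1 E" "\<And>n. g n \<in> L2 \<pi>"
    "\<And>n. L2_norm \<pi> (\<lambda>x. real (Suc n) * f x - g n x) < 1" by metis
  define h where "h n x = g n x / real (Suc n)" for n x
  define d where "d n x = (f x - h n x)\<^sup>2" for n x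
  have hL2: "h n \<in> L2 \<pi>" for n
  proof -
    have "h n = (\<lambda>x. g n x / real (Suc n))" by (simp add: h_def fun_eq_iff)
    then show ?thesis
      using g(2)[of n] by (auto simp: L2_def power_divide simp del: of_nat_Suc)
  qed
  have int_d: "integrable \<pi> (d n)" for n
  proof -
    have "d n = (\<lambda>x. (f x - h n x)\<^sup>2)" by (simp add: d_def fun_eq_iff)
    then show ?thesis using L2_diff[OF f hL2[of n]] by (simp add: L2_def)
  qed
  have d_bound: "(\<integral>x. norm (d n x) \<partial>\<pi>) \<le> inverse (real (Suc n))" for n
  proof -
    have e: "(real (Suc n) * f x - g n x)\<^sup>2 = (real (Suc n))\<^sup>2 * d n x" for x
    proof -
      have "real (Suc n) * f x - g n x = real (Suc n) * (f x - h n x)"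
        unfolding h_def by (simp add: right_diff_distrib del: of_nat_Suc)
      then show ?thesis unfolding d_def by (simp only: power_mult_distrib)
    qed
    have "sqrt (\<integral>x. (real (Suc n) * f x - g n x)\<^sup>2 \<partial>\<pi>) < 1"
      using g(3)[of n] by (simp add: L2_norm_def)
    then have "(real (Suc n))\<^sup>2 * (\<integral>x. d n x \<partial>\<pi>) \<le> 1"
      unfolding e by (simp del: of_nat_Suc)
    then have "(\<integral>x. d n x \<partial>\<pi>) \<le> inverse ((real (Suc n))\<^sup>2)"
      by (simp add: field_simps del: of_nat_Suc)
    also have "\<dots> \<le> inverse (real (Suc n))"
      by (intro le_imp_inverse_le self_le_power) auto
    finally show ?thesis by (simp add: d_def)
  qed
  have "(\<lambda>n. \<integral>x. norm (d n x) \<partial>\<pi>) \<longlonglongrightarrow> 0"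
    by (rule tendsto_sandwich[OF _ _ tendsto_const LIMSEQ_inverse_real_of_nat])
       (rule always_eventually, rule allI, simp, rule always_eventually, rule allI, rule d_bound)
  then obtain r :: "nat \<Rightarrow> nat" where r: "strict_mono r" "AE x in \<pi>. (\<lambda>n. d (r n) x) \<longlonglongrightarrow> 0"
    using tendsto_L1_AE_subseq[of \<pi> d] int_d by auto
  have conv: "(\<lambda>n. h (r n) x) \<longlonglongrightarrow> f x" if "(\<lambda>n. d (r n) x) \<longlonglongrightarrow> 0" for x
  proof -
    have "(\<lambda>n. sqrt (d (r n) x)) \<longlonglongrightarrow> sqrt 0" by (rule tendsto_real_sqrt[OF that])
    then have "(\<lambda>n. \<bar>h (r n) x - f x\<bar>) \<longlonglongrightarrow> 0"
      by (simp add: d_def abs_minus_commute)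
    then show ?thesis by (simp add: LIM_zero_iff tendsto_rabs_zero_iff)
  qed
  have "\<exists>x0\<in>space \<pi>. (\<lambda>n. d (r n) x0) \<longlonglongrightarrow> 0"
  proof (rule ccontr)
    assume "\<not> ?thesis"
    then have no: "\<And>x. x \<in> space \<pi> \<Longrightarrow> \<not> (\<lambda>n. d (r n) x) \<longlonglongrightarrow> 0" by blast
    from r(2) AE_space have "AE x in \<pi>. False"
      by eventually_elim (use no in blast)
    then show False by simp
  qed
  then obtain x0 where x0: "x0 \<in> E" "(\<lambda>n. d (r n) x0) \<longlonglongrightarrow> 0" using sp by auto
  have fx: "f x = f x0" if x: "x \<in> E" "(\<lambda>n. d (r n) x) \<longlonglongrightarrow> 0" for x
  proof -
    have "(\<lambda>n. \<bar>h (r n) x - h (r n) x0\<bar>) \<longlonglongrightarrow> \<bar>f x - f x0\<bar>"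
      by (intro tendsto_intros conv x x0)
    moreover have "(\<lambda>n. \<bar>h (r n) x - h (r n) x0\<bar>) \<longlonglongrightarrow> 0"
    proof (rule tendsto_sandwich[OF _ _ tendsto_const])
      have "(\<lambda>n. \<bar>x - x0\<bar> * inverse (real (Suc (r n)))) \<longlonglongrightarrow> \<bar>x - x0\<bar> * 0"
        using LIMSEQ_subseq_LIMSEQ[OF LIMSEQ_inverse_real_of_nat r(1)]
        by (intro tendsto_intros) (simp add: o_def)
      then show "(\<lambda>n. \<bar>x - x0\<bar> * inverse (real (Suc (r n)))) \<longlonglongrightarrow> 0" by simp
      have "\<bar>h n x - h n x0\<bar> \<le> \<bar>x - x0\<bar> * inverse (real (Suc n))" for n
      proof -
        have "\<bar>g n x - g n x0\<bar> \<le> \<bar>x - x0\<bar>" using g(1)[of n] x x0 by (auto simp: Lip1_def)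
        then show ?thesis
          unfolding h_def diff_divide_distrib[symmetric] abs_divide
          by (simp add: divide_inverse mult_right_mono del: of_nat_Suc)
      qed
      then show "\<forall>\<^sub>F n in sequentially. \<bar>h (r n) x - h (r n) x0\<bar>
          \<le> \<bar>x - x0\<bar> * inverse (real (Suc (r n)))"
        by (intro always_eventually allI)
    qed simp
    ultimately have "\<bar>f x - f x0\<bar> = 0" by (rule LIMSEQ_unique)
    then show ?thesis by simp
  qed
  have "AE x in \<pi>. f x = f x0"
    using r(2) AE_space by eventually_elim (simp add: sp fx)
  then show ?thesis by blast
qed

end

theory Submission
  imports Defs
begin

text \<open>
  Write \<open>m\<close> for the mean of \<open>g\<close> under \<open>\<pi>\<close>.  For a bounded \<open>1\<close>-Lipschitz function \<open>g\<close>, reversibility and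
  invariance express the variance along the semigroup as a covariance,
  \<open>Var(P\<^sub>t g) = \<integral> (g - m) (P\<^sub>2\<^sub>t g - c) d\<pi>\<close>, for every constant \<open>c\<close> (\<open>Var_P_covariance\<close>).  This formula
  is used twice.

  With \<open>c = P\<^sub>2\<^sub>t g(x\<^sub>0)\<close>, the Lipschitz contraction bounds the second factor by
  \<open>e\<^sup>-\<^sup>2\<^sup>\<rho>\<^sup>t |x - x\<^sub>0|\<close>.  So the variance decays at rate \<open>2\<rho>\<close>, though with a constant that depends on \<open>g\<close>,
  as soon as \<open>\<pi>\<close> has a finite first moment.  Positive curvature ensures this (\<open>first_moment\<close>): a process
  started at \<open>x\<^sub>0\<close> stays at bounded mean distance from \<open>x\<^sub>0\<close>, because its laws at successive integer
  times approach each other geometrically, and \<open>\<pi>\<close> is their limit.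

  With \<open>c = m\<close>, the Cauchy-Schwarz inequality gives \<open>Var(P\<^sub>t g)\<^sup>2 \<le> Var(g) Var(P\<^sub>2\<^sub>t g)\<close>
  (\<open>Var_P_log_convex\<close>).  Passing to ever larger times in this inequality dilutes the constant until
  only \<open>Var(g)\<close> is left (\<open>exp_decay_self_improvement\<close>).  This is the sharp bound, and by scaling it holds
  for every multiple of \<open>g\<close>.

  Finally, such multiples are dense in \<open>L\<^sup>2(\<pi>)\<close> and \<open>P\<^sub>t\<close> is a contraction of \<open>L\<^sup>2(\<pi>)\<close>
  (\<open>stationary_L2_contraction\<close>), so the inequality extends to all of \<open>L\<^sup>2(\<pi>)\<close> (\<open>Var_P_L2\<close>).
\<close>

section \<open>Square-integrable functions and the variance\<close>

lemma L2_mult_integrable: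
  assumes "f \<in> L2 \<pi>" "g \<in> L2 \<pi>"
  shows "integrable \<pi> (\<lambda>x. f x * g x)"
proof -
  have [measurable]: "f \<in> borel_measurable \<pi>" "g \<in> borel_measurable \<pi>"
    using assms by (auto simp: L2_def)
  have i: "integrable \<pi> (\<lambda>x. (f x)\<^sup>2 + (g x)\<^sup>2)"
    using assms by (auto simp: L2_def)
  have "norm (f x * g x) \<le> norm ((f x)\<^sup>2 + (g x)\<^sup>2)" for x
  proof -
    have "2 * \<bar>f x * g x\<bar> \<le> (f x)\<^sup>2 + (g x)\<^sup>2"
      using sum_squares_bound[of "\<bar>f x\<bar>" "\<bar>g x\<bar>"] by (simp add: abs_mult)
    then show ?thesis by simp
  qed
  then show ?thesis by (intro Bochner_Integration.integrable_bound[OF i]) auto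
qed

lemma L2_cmult: "f \<in> L2 \<pi> \<Longrightarrow> (\<lambda>x. c * f x) \<in> L2 \<pi>"
  by (auto simp: L2_def power_mult_distrib)

lemma (in finite_measure) integrable_of_bounded:
  fixes f :: "'a \<Rightarrow> real"
  assumes "f \<in> borel_measurable M" "\<And>x. x \<in> space M \<Longrightarrow> \<bar>f x\<bar> \<le> C"
  shows "integrable M f"
  by (rule integrable_const_bound[where B=C]) (use assms in auto)

lemma L2_of_bounded:
  assumes "finite_measure \<pi>" "f \<in> borel_measurable \<pi>" "\<And>x. x \<in> space \<pi> \<Longrightarrow> \<bar>f x\<bar> \<le> C"
  shows "f \<in> L2 \<pi>"
proof -
  interpret finite_measure \<pi> by fact
  have "(f x)\<^sup>2 \<le> C\<^sup>2" if "x \<in> space \<pi>" for x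
    using power_mono[OF assms(3)[OF that], of 2] by simp
  then have "integrable \<pi> (\<lambda>x. (f x)\<^sup>2)"
    using assms(2) by (intro integrable_of_bounded[where C="C\<^sup>2"]) auto
  then show ?thesis using assms(2) by (simp add: L2_def)
qed

lemma L2_norm_nonneg [simp]: "0 \<le> L2_norm \<pi> f"
  by (simp add: L2_norm_def)

lemma L2_norm_power2: "(L2_norm \<pi> f)\<^sup>2 = (\<integral>x. (f x)\<^sup>2 \<partial>\<pi>)"
  by (simp add: L2_norm_def)

lemma L2_Cauchy_Schwarz:
  assumes f: "f \<in> L2 \<pi>" and g: "g \<in> L2 \<pi>"
  shows "(\<integral>x. f x * g x \<partial>\<pi>)\<^sup>2 \<le> (\<integral>x. (f x)\<^sup>2 \<partial>\<pi>) * (\<integral>x. (g x)\<^sup>2 \<partial>\<pi>)"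
proof -
  define a b c where "a = (\<integral>x. (f x)\<^sup>2 \<partial>\<pi>)" and "b = (\<integral>x. f x * g x \<partial>\<pi>)" and "c = (\<integral>x. (g x)\<^sup>2 \<partial>\<pi>)"
  have [simp]: "integrable \<pi> (\<lambda>x. (f x)\<^sup>2)" "integrable \<pi> (\<lambda>x. (g x)\<^sup>2)" "integrable \<pi> (\<lambda>x. f x * g x)"
    using f g L2_mult_integrable[OF f g] by (auto simp: L2_def)
  have quad: "0 \<le> a - 2 * l * b + l\<^sup>2 * c" for l
  proof -
    have "0 \<le> (\<integral>x. (f x - l * g x)\<^sup>2 \<partial>\<pi>)" by simp
    also have "\<dots> = (\<integral>x. (f x)\<^sup>2 - 2 * l * (f x * g x) + l\<^sup>2 * (g x)\<^sup>2 \<partial>\<pi>)"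
      by (intro Bochner_Integration.integral_cong) (auto simp: power2_eq_square algebra_simps)
    also have "\<dots> = a - 2 * l * b + l\<^sup>2 * c"
      by (simp add: a_def b_def c_def)
    finally show ?thesis .
  qed
  have c: "0 \<le> c" by (simp add: c_def)
  have "b\<^sup>2 \<le> a * c"
  proof (cases "c = 0")
    case True
    show ?thesis
    proof (cases "b = 0")
      case False
      \<comment> \<open>without a quadratic term the polynomial is affine, and it takes the value \<open>-1\<close> here\<close>
      then show ?thesis using quad[of "(a + 1) / (2 * b)"] True by simp
    qed (simp add: True)
  next
    case False
    \<comment> \<open>the minimiser of the quadratic polynomial\<close>
    have "0 \<le> c * (a - 2 * (b / c) * b + (b / c)\<^sup>2 * c)"
      using quad[of "b / c"] c by simp
    also have "\<dots> = a * c - b\<^sup>2"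
      using False by (simp add: power2_eq_square field_simps)
    finally show ?thesis by simp
  qed
  then show ?thesis by (simp add: a_def b_def c_def)
qed

lemma L2_norm_triangle:
  assumes f: "f \<in> L2 \<pi>" and g: "g \<in> L2 \<pi>"
  shows "L2_norm \<pi> (\<lambda>x. f x + g x) \<le> L2_norm \<pi> f + L2_norm \<pi> g"
proof (rule power2_le_imp_le)
  have [simp]: "integrable \<pi> (\<lambda>x. (f x)\<^sup>2)" "integrable \<pi> (\<lambda>x. (g x)\<^sup>2)" "integrable \<pi> (\<lambda>x. f x * g x)"
    using f g L2_mult_integrable[OF f g] by (auto simp: L2_def)
  have "\<bar>\<integral>x. f x * g x \<partial>\<pi>\<bar> \<le> L2_norm \<pi> f * L2_norm \<pi> g"
    using L2_Cauchy_Schwarz[OF f g]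
    by - (rule power2_le_imp_le, simp_all add: power_mult_distrib L2_norm_power2)
  then have cs: "(\<integral>x. f x * g x \<partial>\<pi>) \<le> L2_norm \<pi> f * L2_norm \<pi> g" by simp
  have "(L2_norm \<pi> (\<lambda>x. f x + g x))\<^sup>2 = (\<integral>x. (f x)\<^sup>2 + (g x)\<^sup>2 + 2 * (f x * g x) \<partial>\<pi>)"
    unfolding L2_norm_power2
    by (intro Bochner_Integration.integral_cong) (auto simp: power2_eq_square algebra_simps)
  also have "\<dots> = (L2_norm \<pi> f)\<^sup>2 + (L2_norm \<pi> g)\<^sup>2 + 2 * (\<integral>x. f x * g x \<partial>\<pi>)"
    by (simp add: L2_norm_power2)
  also have "\<dots> \<le> (L2_norm \<pi> f + L2_norm \<pi> g)\<^sup>2"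
    using cs by (simp add: power2_sum)
  finally show "(L2_norm \<pi> (\<lambda>x. f x + g x))\<^sup>2 \<le> (L2_norm \<pi> f + L2_norm \<pi> g)\<^sup>2" .
qed simp

lemma L2_imp_integrable:
  assumes "finite_measure \<pi>" "f \<in> L2 \<pi>"
  shows "integrable \<pi> f"
  using assms(2) unfolding L2_def
  by - (rule finite_measure.square_integrable_imp_integrable[OF assms(1)], simp_all)

lemma Var_eq:
  assumes "prob_space \<pi>" "f \<in> L2 \<pi>"
  shows "Var \<pi> f = (\<integral>x. (f x)\<^sup>2 \<partial>\<pi>) - (\<integral>x. f x \<partial>\<pi>)\<^sup>2"
proof -
  interpret prob_space \<pi> by fact
  show ?thesis
    using assms(2) L2_imp_integrable[OF finite_measure_axioms assms(2)]
    unfolding Var_def by (intro variance_eq) (auto simp: L2_def)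
qed

lemma sqrt_Var: "sqrt (Var \<pi> f) = L2_norm \<pi> (\<lambda>x. f x - (\<integral>y. f y \<partial>\<pi>))"
  by (simp add: Var_def L2_norm_def)

lemma Var_nonneg [simp]: "0 \<le> Var \<pi> f"
  by (simp add: Var_def)

text \<open>
  The standard deviation is the \<open>L\<^sup>2\<close> norm of the centred function, and centring is a contraction
  of \<open>L\<^sup>2\<close>.  This Lipschitz bound is what carries the variance estimate from a dense set to all
  of \<open>L\<^sup>2\<close>.
\<close>

lemma sqrt_Var_le:
  assumes \<pi>: "prob_space \<pi>" and f: "f \<in> L2 \<pi>" and g: "g \<in> L2 \<pi>"
  shows "sqrt (Var \<pi> f) \<le> sqrt (Var \<pi> g) + L2_norm \<pi> (\<lambda>x. f x - g x)"
proof -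
  interpret prob_space \<pi> by fact
  let ?m = "\<lambda>f. (\<integral>x. f x \<partial>\<pi>)" and ?d = "\<lambda>x. f x - g x"
  have c: "(\<lambda>x. f x - ?m f) \<in> L2 \<pi>" if "f \<in> L2 \<pi>" for f
    using L2_diff[OF that L2_of_bounded[of \<pi> "\<lambda>_. ?m f" "\<bar>?m f\<bar>"]] finite_measure_axioms by simp
  have d: "?d \<in> L2 \<pi>" by (rule L2_diff[OF f g])
  have "sqrt (Var \<pi> f) = L2_norm \<pi> (\<lambda>x. (g x - ?m g) + (?d x - ?m ?d))"
    unfolding sqrt_Var
    by (subst Bochner_Integration.integral_diff) (auto intro: L2_imp_integrable finite_measure_axioms f g)
  also have "\<dots> \<le> sqrt (Var \<pi> g) + sqrt (Var \<pi> ?d)"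
    unfolding sqrt_Var by (intro L2_norm_triangle c g d)
  also have "Var \<pi> ?d \<le> (L2_norm \<pi> ?d)\<^sup>2"
    unfolding Var_eq[OF \<pi> d] L2_norm_power2 by simp
  then have "sqrt (Var \<pi> ?d) \<le> L2_norm \<pi> ?d" by (intro real_le_lsqrt) auto
  finally show ?thesis by simp
qed

lemma Var_cmult: "Var \<pi> (\<lambda>x. c * f x) = c\<^sup>2 * Var \<pi> f"
proof -
  have "(\<lambda>x. (c * f x - (\<integral>y. c * f y \<partial>\<pi>))\<^sup>2) = (\<lambda>x. c\<^sup>2 * (f x - (\<integral>y. f y \<partial>\<pi>))\<^sup>2)"
    by (simp flip: power_mult_distrib right_diff_distrib)
  then show ?thesis by (simp add: Var_def)
qed

section \<open>Markov kernels with a stationary distribution\<close>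

text \<open>
  For \<open>f\<close> in \<open>L\<^sup>2(\<pi>)\<close> the integral of \<open>f\<close> against \<open>N x\<close> may fail to exist for some \<open>x\<close>, where the
  Bochner integral takes the value \<open>0\<close>.  Stationarity confines these points to a null set, so the
  kernel still acts as a linear contraction of \<open>L\<^sup>2(\<pi>)\<close>.
\<close>

context
  fixes \<pi> :: "real measure" and N :: "real \<Rightarrow> real measure"
  assumes \<pi>: "prob_space \<pi>"
    and N: "N \<in> measurable \<pi> (prob_algebra \<pi>)"
    and stationary: "\<pi> \<bind> N = \<pi>"
begin

interpretation prob_space \<pi> by (rule \<pi>)

lemma N_sub [measurable]: "N \<in> measurable \<pi> (subprob_algebra \<pi>)"
  by (rule measurable_prob_algebraD[OF N])

lemma kernel_prob: "x \<in> space \<pi> \<Longrightarrow> prob_space (N x) \<and> sets (N x) = sets \<pi>"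
  using measurable_space[OF N] by (simp add: space_prob_algebra)

lemma kernel_integral_measurable:
  fixes f :: "real \<Rightarrow> real"
  assumes "f \<in> borel_measurable \<pi>"
  shows "(\<lambda>x. \<integral>y. f y \<partial>N x) \<in> borel_measurable \<pi>"
  by (rule measurable_compose[OF N_sub integral_measurable_subprob_algebra[OF assms]])

lemma stationary_integral:
  fixes f :: "real \<Rightarrow> real"
  assumes "f \<in> borel_measurable \<pi>" "\<And>x. x \<in> space \<pi> \<Longrightarrow> \<bar>f x\<bar> \<le> C"
  shows "(\<integral>x. (\<integral>y. f y \<partial>N x) \<partial>\<pi>) = (\<integral>x. f x \<partial>\<pi>)"
proof -
  have "AE x in \<pi>. emeasure (N x) (space (N x)) \<le> ennreal 1"
    using kernel_prob by (intro AE_I2) (auto simp: prob_space.emeasure_space_1)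
  from integral_bind[OF assms N_sub finite_measure_axioms this] show ?thesis
    by (simp add: stationary)
qed

lemma stationary_L2_integrable:
  assumes f: "f \<in> L2 \<pi>"
  shows "AE x in \<pi>. integrable (N x) f \<and> integrable (N x) (\<lambda>y. (f y)\<^sup>2)"
proof -
  have m [measurable]: "f \<in> borel_measurable \<pi>" using f by (simp add: L2_def)
  have "(\<integral>\<^sup>+x. (\<integral>\<^sup>+y. ennreal ((f y)\<^sup>2) \<partial>N x) \<partial>\<pi>) = (\<integral>\<^sup>+x. ennreal ((f x)\<^sup>2) \<partial>\<pi>)"
    using nn_integral_bind[of "\<lambda>y. ennreal ((f y)\<^sup>2)", OF _ N_sub] by (simp add: stationary)
  also have "\<dots> = ennreal (\<integral>x. (f x)\<^sup>2 \<partial>\<pi>)"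
    using f by (intro nn_integral_eq_integral) (auto simp: L2_def)
  also have "\<dots> \<noteq> \<infinity>" by simp
  finally have fin: "(\<integral>\<^sup>+x. (\<integral>\<^sup>+y. ennreal ((f y)\<^sup>2) \<partial>N x) \<partial>\<pi>) \<noteq> \<infinity>" .
  have "AE x in \<pi>. (\<integral>\<^sup>+y. ennreal ((f y)\<^sup>2) \<partial>N x) \<noteq> \<infinity>"
    by (rule nn_integral_PInf_AE[OF _ fin])
       (rule measurable_compose[OF N_sub nn_integral_measurable_subprob_algebra], measurable)
  then show ?thesis using AE_space
  proof eventually_elim
    case (elim x)
    interpret Nx: prob_space "N x" using kernel_prob[OF elim(2)] by simp
    have "sets (N x) = sets \<pi>" using kernel_prob[OF elim(2)] by simp
    then have [measurable]: "f \<in> borel_measurable (N x)" by (simp cong: measurable_cong_sets)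
    have i: "integrable (N x) (\<lambda>y. (f y)\<^sup>2)"
    proof (rule integrableI_bounded)
      show "(\<lambda>y. (f y)\<^sup>2) \<in> borel_measurable (N x)" by measurable
      show "(\<integral>\<^sup>+y. ennreal (norm ((f y)\<^sup>2)) \<partial>N x) < \<infinity>" using elim(1) by (simp add: less_top)
    qed
    have "integrable (N x) f" by (rule Nx.square_integrable_imp_integrable[OF _ i]) measurable
    with i show ?case by blast
  qed
qed

text \<open>
  Jensen's inequality at almost every point, then stationarity.  The integrals are taken in the
  extended nonnegative reals, because square integrability of the image is part of the claim.
\<close>

lemma stationary_L2_contraction:
  assumes f: "f \<in> L2 \<pi>"
  defines "Pf \<equiv> \<lambda>x. \<integral>y. f y \<partial>N x"
  shows "Pf \<in> L2 \<pi>" and "L2_norm \<pi> Pf \<le> L2_norm \<pi> f"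
proof -
  have m [measurable]: "f \<in> borel_measurable \<pi>" using f by (simp add: L2_def)
  have [measurable]: "Pf \<in> borel_measurable \<pi>" unfolding Pf_def by (rule kernel_integral_measurable[OF m])
  have "(\<integral>\<^sup>+x. ennreal ((Pf x)\<^sup>2) \<partial>\<pi>) \<le> (\<integral>\<^sup>+x. (\<integral>\<^sup>+y. ennreal ((f y)\<^sup>2) \<partial>N x) \<partial>\<pi>)"
  proof (rule nn_integral_mono_AE)
    show "AE x in \<pi>. ennreal ((Pf x)\<^sup>2) \<le> (\<integral>\<^sup>+y. ennreal ((f y)\<^sup>2) \<partial>N x)"
      using stationary_L2_integrable[OF f] AE_space
    proof eventually_elim
      case (elim x)
      interpret Nx: prob_space "N x" using kernel_prob[OF elim(2)] by simp
      have "(Pf x)\<^sup>2 \<le> (\<integral>y. (f y)\<^sup>2 \<partial>N x)"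
        using Nx.variance_positive[of f] Nx.variance_eq[of f] elim(1) by (simp add: Pf_def)
      also have "ennreal \<dots> = (\<integral>\<^sup>+y. ennreal ((f y)\<^sup>2) \<partial>N x)"
        using elim(1) by (intro nn_integral_eq_integral[symmetric]) auto
      finally show ?case by (simp add: ennreal_leI)
    qed
  qed
  also have "\<dots> = (\<integral>\<^sup>+x. ennreal ((f x)\<^sup>2) \<partial>\<pi>)"
    using nn_integral_bind[of "\<lambda>y. ennreal ((f y)\<^sup>2)", OF _ N_sub] by (simp add: stationary)
  also have "\<dots> = ennreal (\<integral>x. (f x)\<^sup>2 \<partial>\<pi>)"
    using f by (intro nn_integral_eq_integral) (auto simp: L2_def)
  finally have le: "(\<integral>\<^sup>+x. ennreal ((Pf x)\<^sup>2) \<partial>\<pi>) \<le> ennreal (\<integral>x. (f x)\<^sup>2 \<partial>\<pi>)" .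
  then have "integrable \<pi> (\<lambda>x. (Pf x)\<^sup>2)"
    by (intro integrableI_bounded) (auto intro: le_less_trans)
  then show "Pf \<in> L2 \<pi>" by (simp add: L2_def)
  have "(\<integral>x. (Pf x)\<^sup>2 \<partial>\<pi>) \<le> (\<integral>x. (f x)\<^sup>2 \<partial>\<pi>)"
    using le \<open>integrable \<pi> (\<lambda>x. (Pf x)\<^sup>2)\<close> by (simp add: nn_integral_eq_integral)
  then show "L2_norm \<pi> Pf \<le> L2_norm \<pi> f" by (simp add: L2_norm_def)
qed

lemma stationary_L2_diff:
  assumes f: "f \<in> L2 \<pi>" and g: "g \<in> L2 \<pi>"
  shows "L2_norm \<pi> (\<lambda>x. (\<integral>y. f y \<partial>N x) - (\<integral>y. g y \<partial>N x)) \<le> L2_norm \<pi> (\<lambda>x. f x - g x)"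
proof -
  have "f \<in> borel_measurable \<pi>" "g \<in> borel_measurable \<pi>" using f g by (auto simp: L2_def)
  note [measurable] = kernel_integral_measurable[OF this(1)] kernel_integral_measurable[OF this(2)]
     kernel_integral_measurable[OF borel_measurable_diff, OF this]
  have "AE x in \<pi>. ((\<integral>y. f y \<partial>N x) - (\<integral>y. g y \<partial>N x))\<^sup>2 = (\<integral>y. f y - g y \<partial>N x)\<^sup>2"
    using stationary_L2_integrable[OF f] stationary_L2_integrable[OF g]
    by eventually_elim simp
  then have "L2_norm \<pi> (\<lambda>x. (\<integral>y. f y \<partial>N x) - (\<integral>y. g y \<partial>N x)) = L2_norm \<pi> (\<lambda>x. \<integral>y. f y - g y \<partial>N x)"
    unfolding L2_norm_def by (intro arg_cong[where f=sqrt] integral_cong_AE) measurable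
  then show ?thesis using stationary_L2_contraction(2)[OF L2_diff[OF f g]] by simp
qed

end

section \<open>Self-improvement of exponential decay\<close>

text \<open>
  The inequality \<open>v(t)\<^sup>2 \<le> A v(2t)\<close> turns an exponential bound with an arbitrary constant \<open>C\<close> into
  the same bound with constant \<open>A\<close>.  Put \<open>w(t) = e\<^sup>c\<^sup>t v(t)\<close>.  The weights match, so
  \<open>w(t)\<^sup>2 \<le> A w(2t)\<close>; the supremum \<open>S\<close> of \<open>w\<close> is finite because \<open>w \<le> C\<close>, and taking suprema gives
  \<open>S\<^sup>2 \<le> A S\<close>, that is, \<open>S \<le> A\<close>.
\<close>

lemma exp_decay_self_improvement:
  fixes v :: "real \<Rightarrow> real"
  assumes v: "\<And>t. 0 \<le> t \<Longrightarrow> 0 \<le> v t" and decay: "\<And>t. 0 \<le> t \<Longrightarrow> v t \<le> C * exp (- c * t)"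
    and convex: "\<And>t. 0 \<le> t \<Longrightarrow> (v t)\<^sup>2 \<le> A * v (2 * t)" and A: "0 \<le> A" and t: "0 \<le> t"
  shows "v t \<le> exp (- c * t) * A"
proof -
  define w where "w t = v t * exp (c * t)" for t
  define S where "S = (SUP t\<in>{0..}. w t)"
  have w0: "0 \<le> w t" if "0 \<le> t" for t using v[OF that] by (simp add: w_def)
  have wC: "w t \<le> C" if "0 \<le> t" for t
    using mult_right_mono[OF decay[OF that], of "exp (c * t)"] by (simp add: w_def exp_minus field_simps)
  have bdd: "bdd_above (w ` {0..})" using wC by (intro bdd_aboveI2) auto
  have wS: "w t \<le> S" if "0 \<le> t" for t unfolding S_def using that by (intro cSUP_upper bdd) auto
  have S0: "0 \<le> S" using wS[of 0] w0[of 0] by simp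
  have "w t \<le> sqrt (A * S)" if "0 \<le> t" for t
  proof (rule real_le_rsqrt)
    have "(w t)\<^sup>2 = (v t)\<^sup>2 * exp (c * (2 * t))"
      by (simp add: w_def power_mult_distrib exp_double[symmetric] algebra_simps)
    also have "\<dots> \<le> A * w (2 * t)"
      using mult_right_mono[OF convex[OF that], of "exp (c * (2 * t))"] by (simp add: w_def)
    also have "\<dots> \<le> A * S" using A wS[of "2 * t"] that by (intro mult_left_mono) auto
    finally show "(w t)\<^sup>2 \<le> A * S" .
  qed
  then have "(SUP t\<in>{0..}. w t) \<le> sqrt (A * S)" by (intro cSUP_least) auto
  then have "S \<le> sqrt (A * S)" by (simp flip: S_def)
  then have "S\<^sup>2 \<le> A * S"
    using S0 A power_mono[of S "sqrt (A * S)" 2] by simp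
  then have "S \<le> A" using S0 A by (cases "S = 0") (auto simp: power2_eq_square)
  then have "w t \<le> A" using wS[OF t] by simp
  then have "w t * exp (- c * t) \<le> A * exp (- c * t)" by (intro mult_right_mono) auto
  then show ?thesis by (simp add: w_def mult.assoc mult.commute[of A] flip: exp_add)
qed

section \<open>Lipschitz functions\<close>

lemma contracts_Lip1D:
  assumes "contracts_Lip1 E Pr X r" "g \<in> Lip1 E" "0 \<le> t" "x \<in> E" "y \<in> E"
  shows "integrable (Pr x) (\<lambda>\<omega>. g (X t \<omega>))"
    and "\<bar>semigroup_of Pr X t g x - semigroup_of Pr X t g y\<bar> \<le> exp (- r * t) * \<bar>x - y\<bar>"
proof -
  have *: "(SUP (x, y) \<in> {(x, y). x \<in> E \<and> y \<in> E \<and> x \<noteq> y}.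
      ereal (\<bar>semigroup_of Pr X t g x - semigroup_of Pr X t g y\<bar> / \<bar>x - y\<bar>)) \<le> ereal (exp (- r * t))"
    and "integrable (Pr x) (\<lambda>\<omega>. g (X t \<omega>))"
    using assms unfolding contracts_Lip1_def by blast+
  then show "integrable (Pr x) (\<lambda>\<omega>. g (X t \<omega>))" by simp
  show "\<bar>semigroup_of Pr X t g x - semigroup_of Pr X t g y\<bar> \<le> exp (- r * t) * \<bar>x - y\<bar>"
  proof (cases "x = y")
    case False
    then have "\<bar>semigroup_of Pr X t g x - semigroup_of Pr X t g y\<bar> / \<bar>x - y\<bar> \<le> exp (- r * t)"
      using *[unfolded SUP_le_iff] assms(4,5) by auto
    then show ?thesis using False by (simp add: pos_divide_le_eq)
  qed simp
qed

text \<open>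
  A Lipschitz function is continuous on \<open>E\<close>, which is enough: the \<open>\<sigma>\<close>-algebra of \<open>borel_on E\<close> is the
  trace of the Borel sets on \<open>E\<close>.
\<close>

lemma Lip1_measurable: "g \<in> Lip1 E \<Longrightarrow> g \<in> borel_measurable (borel_on E)"
proof -
  assume "g \<in> Lip1 E"
  then have "1-lipschitz_on E g" by (auto simp: lipschitz_on_def Lip1_def dist_real_def)
  then have "continuous_on E g" by (rule lipschitz_on_continuous_on)
  then show ?thesis by (rule borel_measurable_continuous_on_restrict)
qed

lemma Lip1_dist_trunc: "(\<lambda>x. min \<bar>x - x0\<bar> K) \<in> Lip1 E"
  by (auto simp: Lip1_def min_def abs_if)

lemma Lip1_clamp: "g \<in> Lip1 E \<Longrightarrow> (\<lambda>x. max (- C) (min C (g x))) \<in> Lip1 E"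
proof -
  have "\<bar>max (- C) (min C a) - max (- C) (min C b)\<bar> \<le> \<bar>a - b\<bar>" for a b :: real
    by (auto simp: min_def max_def abs_if)
  then show "g \<in> Lip1 E \<Longrightarrow> (\<lambda>x. max (- C) (min C (g x))) \<in> Lip1 E"
    unfolding Lip1_def by (blast intro: order_trans)
qed

section \<open>The transition semigroup\<close>

context markov_process
begin

abbreviation P :: "real \<Rightarrow> (real \<Rightarrow> real) \<Rightarrow> real \<Rightarrow> real" where
  "P \<equiv> semigroup_of Pr X"

definition kernel :: "real \<Rightarrow> real \<Rightarrow> real measure" where
  "kernel t x = distr (Pr x) (borel_on E) (X t)"

lemma space_Pr: "x \<in> E \<Longrightarrow> space (Pr x) = space \<Omega>"
  by (rule sets_eq_imp_space_eq[OF sets_Pr])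

lemma measurable_X_Pr: "x \<in> E \<Longrightarrow> 0 \<le> t \<Longrightarrow> X t \<in> measurable (Pr x) (borel_on E)"
  using measurable_X[of t] measurable_cong_sets[OF sets_Pr refl, of x "borel_on E"] by simp

lemma sets_kernel [simp]: "sets (kernel t x) = sets (borel_on E)"
  by (simp add: kernel_def)

lemma space_kernel [simp]: "space (kernel t x) = E"
  by (simp add: kernel_def space_restrict_space)

lemma prob_space_kernel: "x \<in> E \<Longrightarrow> 0 \<le> t \<Longrightarrow> prob_space (kernel t x)"
  unfolding kernel_def by (intro prob_space.prob_space_distr prob measurable_X_Pr)

lemma emeasure_kernel:
  assumes "x \<in> E" "0 \<le> t" "A \<in> sets (borel_on E)"
  shows "emeasure (kernel t x) A = ennreal (measure (Pr x) (X t -` A \<inter> space \<Omega>))"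
proof -
  interpret prob_space "Pr x" by (rule prob[OF assms(1)])
  show ?thesis
    using assms measurable_X_Pr[OF assms(1,2)]
    by (simp add: kernel_def emeasure_distr space_Pr emeasure_eq_measure)
qed

lemma measurable_kernel:
  assumes t: "0 \<le> t"
  shows "kernel t \<in> measurable (borel_on E) (prob_algebra (borel_on E))"
proof (rule measurable_prob_algebra_generated)
  show "sets (borel_on E) = sigma_sets (space (borel_on E)) (sets (borel_on E))"
    by (rule sets.sigma_sets_eq[symmetric])
  show "Int_stable (sets (borel_on E))" by (rule sets.Int_stable)
  show "sets (borel_on E) \<subseteq> Pow (space (borel_on E))" by (rule sets.space_closed)
  fix A assume A: "A \<in> sets (borel_on E)"
  have "(\<lambda>x. ennreal (measure (Pr x) (X t -` A \<inter> space \<Omega>))) \<in> borel_measurable (borel_on E)"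
    using measurable_transition[OF t A] by measurable
  then show "(\<lambda>x. emeasure (kernel t x) A) \<in> borel_measurable (borel_on E)"
    by (rule measurable_cong[THEN iffD1, rotated])
       (simp add: emeasure_kernel t A space_restrict_space)
qed (auto simp: space_restrict_space t intro: prob_space_kernel)

lemma subprob_kernel:
  "0 \<le> t \<Longrightarrow> kernel t \<in> measurable (borel_on E) (subprob_algebra (borel_on E))"
  by (rule measurable_prob_algebraD[OF measurable_kernel])

lemma subalgebra_natural_filtration:
  assumes x: "x \<in> E"
  shows "subalgebra (Pr x) (natural_filtration E \<Omega> X s)"
proof -
  let ?G = "\<Union>u\<in>{0..s}. {X u -` A \<inter> space \<Omega> |A. A \<in> sets (borel_on E)}"
  have "?G \<subseteq> sets \<Omega>" using measurable_sets[OF measurable_X] by auto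
  moreover from this have "?G \<subseteq> Pow (space \<Omega>)" using sets.space_closed by blast
  ultimately show ?thesis
    unfolding subalgebra_def natural_filtration_def
    by (simp add: space_Pr x sets_Pr sets.sigma_sets_subset)
qed

text \<open>
  Both sides give a set \<open>A\<close> the same mass: integrating the Markov property at time \<open>s\<close> over \<open>Pr x\<close>
  removes the conditional expectation, which has the same mean as the indicator of
  \<open>X (s + t) \<in> A\<close>.
\<close>

lemma Chapman_Kolmogorov:
  assumes x: "x \<in> E" and s: "0 \<le> s" and t: "0 \<le> t"
  shows "kernel s x \<bind> kernel t = kernel (s + t) x"
proof (rule measure_eqI)
  interpret prob_space "Pr x" by (rule prob[OF x])
  interpret F: finite_measure_subalgebra "Pr x" "natural_filtration E \<Omega> X s"
    by unfold_locales (rule subalgebra_natural_filtration[OF x])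
  have k: "kernel t \<in> measurable (kernel s x) (subprob_algebra (borel_on E))"
    using subprob_kernel[OF t] by (simp cong: measurable_cong_sets)
  have ne: "space (kernel s x) \<noteq> {}" using x by auto
  show sets: "sets (kernel s x \<bind> kernel t) = sets (kernel (s + t) x)"
    using ne by (subst sets_bind[where N="borel_on E"]) auto
  fix A assume "A \<in> sets (kernel s x \<bind> kernel t)"
  then have A: "A \<in> sets (borel_on E)" unfolding sets by simp
  let ?p = "\<lambda>y. measure (Pr y) (X t -` A \<inter> space \<Omega>)"
  let ?i = "\<lambda>\<omega>. indicator A (X (s + t) \<omega>) :: real"
  have [measurable]: "X s \<in> measurable (Pr x) (borel_on E)" "X (s + t) \<in> measurable (Pr x) (borel_on E)"
     "?p \<in> borel_measurable (borel_on E)" "A \<in> sets (borel_on E)"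
    using measurable_transition[OF t A] A x s t by (auto intro: measurable_X_Pr)
  have XE: "X s \<omega> \<in> E" if "\<omega> \<in> space (Pr x)" for \<omega>
    using measurable_space[OF measurable_X_Pr[OF x s] that] by (simp add: space_restrict_space)
  have int_i: "integrable (Pr x) ?i"
    by (rule integrable_of_bounded[where C=1]) (auto simp: indicator_def)
  have "emeasure (kernel s x \<bind> kernel t) A = (\<integral>\<^sup>+y. emeasure (kernel t y) A \<partial>kernel s x)"
    by (rule emeasure_bind[OF ne k A])
  also have "\<dots> = (\<integral>\<^sup>+y. ennreal (?p y) \<partial>kernel s x)"
    by (intro nn_integral_cong) (simp add: emeasure_kernel t A)
  also have "\<dots> = (\<integral>\<^sup>+\<omega>. ennreal (?p (X s \<omega>)) \<partial>Pr x)"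
    unfolding kernel_def by (subst nn_integral_distr) auto
  also have "\<dots> = ennreal (\<integral>\<omega>. ?p (X s \<omega>) \<partial>Pr x)"
  proof (rule nn_integral_eq_integral)
    show "integrable (Pr x) (\<lambda>\<omega>. ?p (X s \<omega>))"
      by (rule integrable_of_bounded[where C=1])
         (auto simp: prob_space.prob_le_1[OF prob] XE)
  qed simp
  also have "(\<integral>\<omega>. ?p (X s \<omega>) \<partial>Pr x)
      = (\<integral>\<omega>. real_cond_exp (Pr x) (natural_filtration E \<Omega> X s) ?i \<omega> \<partial>Pr x)"
    using markov[OF x s t A] by (intro integral_cong_AE) auto
  also have "\<dots> = (\<integral>\<omega>. ?i \<omega> \<partial>Pr x)"
    by (rule F.real_cond_exp_int(2)[OF int_i])
  also have "\<dots> = (\<integral>y. indicator A y \<partial>kernel (s + t) x)"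
    unfolding kernel_def by (subst integral_distr) auto
  also have "ennreal \<dots> = emeasure (kernel (s + t) x) A"
    using prob_space_kernel[OF x, of "s + t"] s t sets.sets_into_space[OF A]
    by (simp add: Int_absorb2 space_restrict_space prob_space_def finite_measure.emeasure_eq_measure)
  finally show "emeasure (kernel s x \<bind> kernel t) A = emeasure (kernel (s + t) x) A" .
qed

lemma P_eq_kernel:
  assumes "g \<in> borel_measurable (borel_on E)" "0 \<le> t" "x \<in> E"
  shows "P t g x = (\<integral>y. g y \<partial>kernel t x)"
  unfolding semigroup_of_def kernel_def
  using assms by (subst integral_distr) (auto intro: measurable_X_Pr)

lemma P_measurable:
  assumes g: "g \<in> borel_measurable (borel_on E)" and t: "0 \<le> t"
  shows "P t g \<in> borel_measurable (borel_on E)"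
  using measurable_compose[OF subprob_kernel[OF t] integral_measurable_subprob_algebra[OF g]]
  by (rule measurable_cong[THEN iffD1, rotated]) (simp add: P_eq_kernel g t space_restrict_space)

lemma integrable_kernel_of_bounded:
  assumes g: "g \<in> borel_measurable (borel_on E)" and C: "\<And>x. x \<in> E \<Longrightarrow> \<bar>g x\<bar> \<le> C"
    and "0 \<le> t" "x \<in> E"
  shows "integrable (kernel t x) (g :: real \<Rightarrow> real)"
proof -
  interpret prob_space "kernel t x" using assms by (intro prob_space_kernel)
  show ?thesis
    using g C by (intro integrable_of_bounded[where C=C]) (auto cong: measurable_cong_sets)
qed

lemma P_bounded:
  assumes g: "g \<in> borel_measurable (borel_on E)" and C: "\<And>x. x \<in> E \<Longrightarrow> \<bar>g x\<bar> \<le> C"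
    and t: "0 \<le> t" and x: "x \<in> E"
  shows "\<bar>P t g x\<bar> \<le> C"
proof -
  interpret prob_space "kernel t x" using x t by (intro prob_space_kernel)
  have "\<bar>\<integral>y. g y \<partial>kernel t x\<bar> \<le> (\<integral>y. \<bar>g y\<bar> \<partial>kernel t x)"
    by (rule integral_abs_bound)
  also have "\<dots> \<le> (\<integral>y. C \<partial>kernel t x)"
    using integrable_kernel_of_bounded[OF g C t x] C by (intro integral_mono) auto
  finally show ?thesis using prob_space by (simp add: P_eq_kernel g t x)
qed

text \<open>
  The semigroup property holds at every point of \<open>E\<close> for bounded functions; for unbounded ones an
  integral could diverge.
\<close>

lemma P_add:
  assumes g: "g \<in> borel_measurable (borel_on E)" and C: "\<And>x. x \<in> E \<Longrightarrow> \<bar>g x\<bar> \<le> C"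
    and s: "0 \<le> s" and t: "0 \<le> t" and x: "x \<in> E"
  shows "P (s + t) g x = P s (P t g) x"
proof -
  interpret prob_space "kernel s x" using x s by (intro prob_space_kernel)
  have k: "kernel t \<in> measurable (kernel s x) (subprob_algebra (borel_on E))"
    using subprob_kernel[OF t] by (simp cong: measurable_cong_sets)
  have "P (s + t) g x = (\<integral>y. g y \<partial>(kernel s x \<bind> kernel t))"
    using s t by (simp add: P_eq_kernel g x Chapman_Kolmogorov)
  also have "\<dots> = (\<integral>y. (\<integral>z. g z \<partial>kernel t y) \<partial>kernel s x)"
  proof (rule integral_bind[OF g _ k finite_measure_axioms])
    show "\<bar>g y\<bar> \<le> C" if "y \<in> space (borel_on E)" for y
      using C that by (simp add: space_restrict_space)
    show "AE y in kernel s x. emeasure (kernel t y) (space (kernel t y)) \<le> ennreal 1"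
      using prob_space.emeasure_space_1[OF prob_space_kernel[OF _ t]] by (intro AE_I2) simp
  qed
  also have "\<dots> = (\<integral>y. P t g y \<partial>kernel s x)"
    by (intro Bochner_Integration.integral_cong) (simp_all add: P_eq_kernel g t)
  also have "\<dots> = P s (P t g) x"
    by (rule P_eq_kernel[symmetric, OF P_measurable[OF g t] s x])
  finally show ?thesis .
qed

lemma P_0:
  assumes g: "g \<in> borel_measurable (borel_on E)" and x: "x \<in> E"
  shows "P 0 g x = g x"
proof -
  interpret prob_space "Pr x" by (rule prob[OF x])
  have [measurable]: "X 0 \<in> measurable (Pr x) (borel_on E)" by (rule measurable_X_Pr[OF x]) simp
  have "P 0 g x = (\<integral>\<omega>. g x \<partial>Pr x)"
    unfolding semigroup_of_def using start[OF x]
    by (intro integral_cong_AE) (use g in \<open>auto elim: eventually_mono\<close>)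
  then show ?thesis by (simp add: prob_space)
qed

text \<open>
  The expected value of \<open>g\<close> started from \<open>x0\<close> has an upper bound independent of time, uniformly over the
  \<open>1\<close>-Lipschitz functions \<open>g\<close> that vanish at \<open>x0\<close>: by the semigroup property, increasing the time from \<open>n\<close> to \<open>n + 1\<close>
  replaces \<open>P n g x0\<close> by its average after one step from \<open>x0\<close>.  As \<open>P n g\<close> has Lipschitz constant
  \<open>e\<^sup>-\<^sup>r\<^sup>n\<close>, the change is at most \<open>e\<^sup>-\<^sup>r\<^sup>n\<close> times the mean length of that step, and these changes sum
  to a geometric series.  The bound does not involve \<open>C\<close>, so it survives the removal of a
  truncation.
\<close>

lemma P_at_base_point_bounded:
  assumes contr: "contracts_Lip1 E Pr X r" and r: "0 < r" and x0: "x0 \<in> E"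
    and g: "g \<in> Lip1 E" and C: "\<And>x. x \<in> E \<Longrightarrow> \<bar>g x\<bar> \<le> C" and g0: "g x0 = 0"
  shows "P (real n) g x0 \<le> P 1 (\<lambda>y. \<bar>y - x0\<bar>) x0 / (1 - exp (- r))"
proof -
  define d where "d = (\<lambda>y. \<bar>y - x0\<bar>)"
  define m where "m = P 1 d x0"
  define q where "q = exp (- r)"
  have q: "0 < q" "q < 1" using r by (auto simp: q_def)
  have d: "d \<in> Lip1 E" by (auto simp: Lip1_def d_def)
  have gm: "g \<in> borel_measurable (borel_on E)" by (rule Lip1_measurable[OF g])
  have m0: "0 \<le> m" by (simp add: m_def semigroup_of_def d_def)
  interpret K: prob_space "kernel 1 x0" by (rule prob_space_kernel[OF x0]) simp
  have [measurable]: "X 1 \<in> measurable (Pr x0) (borel_on E)" by (rule measurable_X_Pr[OF x0]) simp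
  have int_d: "integrable (kernel 1 x0) d"
    unfolding kernel_def using contracts_Lip1D(1)[OF contr d, of 1 x0] x0 Lip1_measurable[OF d]
    by (subst integrable_distr_eq) auto
  have step: "P (real (Suc n)) g x0 \<le> P (real n) g x0 + m * q ^ n" for n
  proof -
    have Pm: "P (real n) g \<in> borel_measurable (borel_on E)" by (rule P_measurable[OF gm]) simp
    have Pb: "\<bar>P (real n) g x\<bar> \<le> C" if "x \<in> E" for x
      by (rule P_bounded[OF gm C _ that]) auto
    have int_P: "integrable (kernel 1 x0) (P (real n) g)"
      by (rule integrable_kernel_of_bounded[OF Pm Pb _ x0]) auto
    have qn: "q ^ n = exp (- r * real n)"
      by (simp add: q_def exp_of_nat_mult[symmetric] mult.commute)
    have "P (real (Suc n)) g x0 = (\<integral>y. P (real n) g y \<partial>kernel 1 x0)"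
      using P_add[OF gm C, of 1 "real n" x0] x0 P_eq_kernel[OF Pm, of 1 x0] by simp
    also have "\<dots> \<le> (\<integral>y. P (real n) g x0 + q ^ n * d y \<partial>kernel 1 x0)"
    proof (rule integral_mono)
      fix y assume "y \<in> space (kernel 1 x0)"
      then show "P (real n) g y \<le> P (real n) g x0 + q ^ n * d y"
        using contracts_Lip1D(2)[OF contr g, of "real n" y x0] x0 by (simp add: qn d_def)
    qed (use int_P int_d in auto)
    also have "\<dots> = P (real n) g x0 + m * q ^ n"
      using int_d K.prob_space P_eq_kernel[OF Lip1_measurable[OF d], of 1 x0] x0 by (simp add: m_def)
    finally show ?thesis .
  qed
  have "P (real n) g x0 \<le> m * (\<Sum>k<n. q ^ k)"
  proof (induction n)
    case 0
    then show ?case using P_0[OF gm x0] g0 by simp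
  next
    case (Suc n)
    then show ?case using step[of n] by (simp add: distrib_left)
  qed
  also have "(\<Sum>k<n. q ^ k) \<le> 1 / (1 - q)"
    using q by (simp add: sum_gp_strict divide_right_mono)
  then have "m * (\<Sum>k<n. q ^ k) \<le> m / (1 - q)"
    using mult_left_mono[OF _ m0] by fastforce
  finally show ?thesis by (simp add: m_def q_def d_def)
qed

section \<open>The semigroup under its invariant distribution\<close>

context
  fixes \<pi> :: "real measure"
  assumes inv: "invariant_distribution E Pr X \<pi>"
begin

lemma prob_space_\<pi>: "prob_space \<pi>" and sets_\<pi>: "sets \<pi> = sets (borel_on E)"
  using inv by (simp_all add: invariant_distribution_def)

interpretation prob_space \<pi> by (rule prob_space_\<pi>)

lemma space_\<pi>: "space \<pi> = E"
  using sets_eq_imp_space_eq[OF sets_\<pi>] by (simp add: space_restrict_space)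

lemma measurable_\<pi>: "measurable \<pi> M = measurable (borel_on E) M"
  by (rule measurable_cong_sets[OF sets_\<pi> refl])

lemma measurable_kernel_\<pi>: "0 \<le> t \<Longrightarrow> kernel t \<in> measurable \<pi> (prob_algebra \<pi>)"
  using measurable_kernel
  by (simp add: measurable_\<pi> prob_algebra_def subprob_algebra_cong[OF sets_\<pi>])

lemma bind_kernel:
  assumes t: "0 \<le> t"
  shows "\<pi> \<bind> kernel t = \<pi>"
proof (rule measure_eqI)
  have k: "kernel t \<in> measurable \<pi> (subprob_algebra (borel_on E))"
    using subprob_kernel[OF t] by (simp add: measurable_\<pi>)
  show sets: "sets (\<pi> \<bind> kernel t) = sets \<pi>"
    using not_empty by (subst sets_bind[where N="borel_on E"]) (auto simp: sets_\<pi>)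
  fix A assume "A \<in> sets (\<pi> \<bind> kernel t)"
  then have A: "A \<in> sets (borel_on E)" unfolding sets sets_\<pi> .
  have meas: "P t (indicator A) \<in> borel_measurable (borel_on E)"
    by (rule P_measurable[OF _ t]) (use A in measurable)
  have e: "emeasure (kernel t x) A = ennreal (P t (indicator A) x)" if "x \<in> E" for x
  proof -
    interpret K: prob_space "kernel t x" by (rule prob_space_kernel[OF that t])
    show ?thesis
      using that A sets.sets_into_space[OF A]
      by (simp add: P_eq_kernel t K.emeasure_eq_measure Int_absorb2 space_restrict_space)
  qed
  have b: "0 \<le> P t (indicator A) x \<and> P t (indicator A) x \<le> 1" if "x \<in> E" for x
    using P_bounded[of "indicator A" 1 t x] t A that
    by (auto simp: semigroup_of_def indicator_def)
  have "emeasure (\<pi> \<bind> kernel t) A = (\<integral>\<^sup>+x. emeasure (kernel t x) A \<partial>\<pi>)"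
    by (rule emeasure_bind[OF not_empty k A])
  also have "\<dots> = (\<integral>\<^sup>+x. ennreal (P t (indicator A) x) \<partial>\<pi>)"
    by (intro nn_integral_cong) (simp add: e space_\<pi>)
  also have "\<dots> = ennreal (\<integral>x. P t (indicator A) x \<partial>\<pi>)"
    using b meas
    by (intro nn_integral_eq_integral integrable_of_bounded[where C=1] AE_I2)
       (auto simp: space_\<pi> measurable_\<pi>)
  also have "\<dots> = emeasure \<pi> A"
    using inv t A by (simp add: invariant_distribution_def emeasure_eq_measure)
  finally show "emeasure (\<pi> \<bind> kernel t) A = emeasure \<pi> A" .
qed

lemma integral_P:
  assumes g: "g \<in> borel_measurable (borel_on E)" and C: "\<And>x. x \<in> E \<Longrightarrow> \<bar>g x\<bar> \<le> C" and t: "0 \<le> t"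
  shows "(\<integral>x. P t g x \<partial>\<pi>) = (\<integral>x. g x \<partial>\<pi>)"
proof -
  have "(\<integral>x. P t g x \<partial>\<pi>) = (\<integral>x. (\<integral>y. g y \<partial>kernel t x) \<partial>\<pi>)"
    by (intro Bochner_Integration.integral_cong) (simp_all add: P_eq_kernel g t space_\<pi>)
  also have "\<dots> = (\<integral>x. g x \<partial>\<pi>)"
    using g C
    by (intro stationary_integral[OF prob_space_\<pi> measurable_kernel_\<pi>[OF t] bind_kernel[OF t]])
       (auto simp: measurable_\<pi> space_\<pi>)
  finally show ?thesis .
qed

lemma L2_cong: "(\<And>x. x \<in> E \<Longrightarrow> f x = g x) \<Longrightarrow> f \<in> L2 \<pi> \<longleftrightarrow> g \<in> L2 \<pi>"
  unfolding L2_def using measurable_cong[of \<pi> f g borel]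
    Bochner_Integration.integrable_cong[of \<pi> \<pi> "\<lambda>x. (f x)\<^sup>2" "\<lambda>x. (g x)\<^sup>2"]
  by (auto simp: space_\<pi>)

lemma L2_norm_cong: "(\<And>x. x \<in> E \<Longrightarrow> f x = g x) \<Longrightarrow> L2_norm \<pi> f = L2_norm \<pi> g"
  unfolding L2_norm_def
  by (intro arg_cong[where f=sqrt] Bochner_Integration.integral_cong) (auto simp: space_\<pi>)

lemma P_L2:
  assumes f: "f \<in> L2 \<pi>" and t: "0 \<le> t"
  shows "P t f \<in> L2 \<pi>"
proof -
  have "f \<in> borel_measurable (borel_on E)" using f by (simp add: L2_def measurable_\<pi>)
  then show ?thesis
    using stationary_L2_contraction(1)[OF prob_space_\<pi> measurable_kernel_\<pi>[OF t] bind_kernel[OF t] f]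
    by (subst L2_cong[of "P t f" "\<lambda>x. \<integral>y. f y \<partial>kernel t x"]) (simp_all add: P_eq_kernel t)
qed

lemma P_L2_diff:
  assumes f: "f \<in> L2 \<pi>" and g: "g \<in> L2 \<pi>" and t: "0 \<le> t"
  shows "L2_norm \<pi> (\<lambda>x. P t f x - P t g x) \<le> L2_norm \<pi> (\<lambda>x. f x - g x)"
proof -
  have m: "f \<in> borel_measurable (borel_on E)" "g \<in> borel_measurable (borel_on E)"
    using f g by (auto simp: L2_def measurable_\<pi>)
  show ?thesis
    using stationary_L2_diff[OF prob_space_\<pi> measurable_kernel_\<pi>[OF t] bind_kernel[OF t] f g]
    by (subst L2_norm_cong[where g="\<lambda>x. (\<integral>y. f y \<partial>kernel t x) - (\<integral>y. g y \<partial>kernel t x)"])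
       (simp_all add: P_eq_kernel m t)
qed

section \<open>Finiteness of the first moment\<close>

text \<open>
  Contraction makes the process forget its starting point: \<open>P n g x - P n g x0\<close> tends to \<open>0\<close> for
  every \<open>x\<close>.  By invariance the integral of \<open>P n g\<close> is that of \<open>g\<close>, so by dominated convergence
  the latter is the limit of \<open>P n g x0\<close>.
\<close>

lemma integral_le_base_point:
  assumes contr: "contracts_Lip1 E Pr X r" and r: "0 < r" and x0: "x0 \<in> E"
    and g: "g \<in> Lip1 E" and C: "\<And>x. x \<in> E \<Longrightarrow> \<bar>g x\<bar> \<le> C"
    and S: "\<And>n. P (real n) g x0 \<le> S"
  shows "(\<integral>x. g x \<partial>\<pi>) \<le> S"
proof -
  have gm: "g \<in> borel_measurable (borel_on E)" by (rule Lip1_measurable[OF g])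
  have Pm [measurable]: "P (real n) g \<in> borel_measurable \<pi>" for n
    unfolding measurable_\<pi> by (rule P_measurable[OF gm]) simp
  have Pb: "\<bar>P (real n) g x\<bar> \<le> C" if "x \<in> E" for n x
    by (rule P_bounded[OF gm C _ that]) auto
  have "(\<lambda>n. \<integral>x. P (real n) g x - P (real n) g x0 \<partial>\<pi>) \<longlonglongrightarrow> (\<integral>x. 0 \<partial>\<pi>)"
  proof (rule integral_dominated_convergence[where w="\<lambda>_. 2 * C"])
    show "AE x in \<pi>. (\<lambda>n. P (real n) g x - P (real n) g x0) \<longlonglongrightarrow> 0"
    proof (rule AE_I2)
      fix x assume "x \<in> space \<pi>"
      then have x: "x \<in> E" by (simp add: space_\<pi>)
      have "(\<lambda>n. exp (- r) ^ n * \<bar>x - x0\<bar>) \<longlonglongrightarrow> 0 * \<bar>x - x0\<bar>"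
        using r by (intro tendsto_intros LIMSEQ_realpow_zero) auto
      moreover have "norm (P (real n) g x - P (real n) g x0) \<le> exp (- r) ^ n * \<bar>x - x0\<bar>" for n
        using contracts_Lip1D(2)[OF contr g _ x x0, of "real n"]
        by (simp add: exp_of_nat_mult[symmetric] mult.commute)
      ultimately show "(\<lambda>n. P (real n) g x - P (real n) g x0) \<longlonglongrightarrow> 0"
        by - (rule Lim_null_comparison[OF always_eventually], simp_all)
    qed
    show "AE x in \<pi>. norm (P (real n) g x - P (real n) g x0) \<le> 2 * C" for n
      using Pb[of _ n] Pb[OF x0, of n] by (intro AE_I2) (force simp: space_\<pi>)
  qed auto
  moreover have "(\<integral>x. P (real n) g x - P (real n) g x0 \<partial>\<pi>) = (\<integral>x. g x \<partial>\<pi>) - P (real n) g x0" for n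
  proof -
    have "integrable \<pi> (P (real n) g)"
      by (rule integrable_of_bounded[where C=C, OF Pm]) (simp add: Pb space_\<pi>)
    then show ?thesis using integral_P[OF gm C, of "real n"] by (simp add: prob_space)
  qed
  ultimately have "(\<lambda>n. (\<integral>x. g x \<partial>\<pi>) - P (real n) g x0) \<longlonglongrightarrow> 0" by simp
  moreover have "(\<integral>x. g x \<partial>\<pi>) - S \<le> (\<integral>x. g x \<partial>\<pi>) - P (real n) g x0" for n
    using S[of n] by simp
  ultimately have "(\<integral>x. g x \<partial>\<pi>) - S \<le> 0"
    by (intro LIMSEQ_le_const) auto
  then show ?thesis by simp
qed

text \<open>
  The distances truncated at height \<open>K\<close> are bounded and \<open>1\<close>-Lipschitz, and their integrals have a
  bound independent of \<open>K\<close>; Fatou's lemma removes the truncation.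
\<close>

lemma first_moment:
  assumes contr: "contracts_Lip1 E Pr X r" and r: "0 < r" and x0: "x0 \<in> E"
  shows "integrable \<pi> (\<lambda>x. \<bar>x - x0\<bar>)"
proof (rule integrableI_bounded)
  have id [measurable]: "(\<lambda>x. x) \<in> borel_measurable \<pi>"
    unfolding measurable_\<pi> by (rule measurable_restrict_space1) simp
  show "(\<lambda>x. \<bar>x - x0\<bar>) \<in> borel_measurable \<pi>" by measurable
  define S where "S = P 1 (\<lambda>y. \<bar>y - x0\<bar>) x0 / (1 - exp (- r))"
  have le: "(\<integral>\<^sup>+x. ennreal (min \<bar>x - x0\<bar> (real K)) \<partial>\<pi>) \<le> ennreal S" for K
  proof -
    have "(\<integral>x. min \<bar>x - x0\<bar> (real K) \<partial>\<pi>) \<le> S"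
    proof (rule integral_le_base_point[OF contr r x0 Lip1_dist_trunc, where C=K])
      show "P (real n) (\<lambda>x. min \<bar>x - x0\<bar> (real K)) x0 \<le> S" for n
        unfolding S_def
        by (rule P_at_base_point_bounded[OF contr r x0 Lip1_dist_trunc, where C=K]) auto
    qed auto
    then show ?thesis
      by (subst nn_integral_eq_integral) (auto intro!: ennreal_leI integrable_of_bounded[where C=K])
  qed
  have "(\<integral>\<^sup>+x. ennreal \<bar>x - x0\<bar> \<partial>\<pi>)
      = (\<integral>\<^sup>+x. liminf (\<lambda>K. ennreal (min \<bar>x - x0\<bar> (real K))) \<partial>\<pi>)"
  proof (intro nn_integral_cong)
    fix x
    obtain K0 :: nat where "\<bar>x - x0\<bar> \<le> real K0" using real_arch_simple by blast
    then have "\<forall>\<^sub>F K in sequentially. ennreal (min \<bar>x - x0\<bar> (real K)) = ennreal \<bar>x - x0\<bar>"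
      unfolding eventually_sequentially by (intro exI[of _ K0]) auto
    then have "(\<lambda>K. ennreal (min \<bar>x - x0\<bar> (real K))) \<longlonglongrightarrow> ennreal \<bar>x - x0\<bar>"
      by (rule tendsto_eventually)
    then show "ennreal \<bar>x - x0\<bar> = liminf (\<lambda>K. ennreal (min \<bar>x - x0\<bar> (real K)))"
      by (intro lim_imp_Liminf[symmetric]) auto
  qed
  also have "\<dots> \<le> liminf (\<lambda>K. \<integral>\<^sup>+x. ennreal (min \<bar>x - x0\<bar> (real K)) \<partial>\<pi>)"
    by (rule nn_integral_liminf) measurable
  also have "\<dots> \<le> liminf (\<lambda>K. ennreal S)"
    by (intro Liminf_mono always_eventually allI le)
  also have "\<dots> < \<infinity>" by (simp add: Liminf_const)
  finally show "(\<integral>\<^sup>+x. ennreal (norm \<bar>x - x0\<bar>) \<partial>\<pi>) < \<infinity>" by simp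
qed

section \<open>Decay of the variance\<close>

text \<open>
  Reversibility moves one factor \<open>P t\<close> of \<open>(P t g)\<^sup>2\<close> to the other side, which leaves the covariance of
  \<open>g\<close> and \<open>P (2 * t) g\<close>.  Since the centred \<open>g\<close> has mean zero, any constant \<open>c\<close> may be subtracted
  from the second factor.  Two choices matter: the mean of \<open>g\<close> gives log-convexity, and the value
  of \<open>P (2 * t) g\<close> at a base point gives decay.
\<close>

lemma Var_P_covariance:
  assumes rev: "reversible Pr X \<pi>" and t: "0 \<le> t"
    and g: "g \<in> borel_measurable (borel_on E)" and C: "\<And>x. x \<in> E \<Longrightarrow> \<bar>g x\<bar> \<le> C"
  shows "Var \<pi> (P t g) = (\<integral>x. (g x - (\<integral>y. g y \<partial>\<pi>)) * (P (2 * t) g x - c) \<partial>\<pi>)"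
proof -
  define m where "m = (\<integral>x. g x \<partial>\<pi>)"
  have gL: "g \<in> L2 \<pi>"
    by (rule L2_of_bounded[OF finite_measure_axioms]) (use g C in \<open>auto simp: measurable_\<pi> space_\<pi>\<close>)
  have PL: "P t g \<in> L2 \<pi>" "P (2 * t) g \<in> L2 \<pi>" using P_L2[OF gL] t by auto
  note [simp] = L2_imp_integrable[OF finite_measure_axioms gL]
    L2_imp_integrable[OF finite_measure_axioms PL(2)] L2_mult_integrable[OF gL PL(2)]
  have "(\<integral>x. (P t g x)\<^sup>2 \<partial>\<pi>) = (\<integral>x. P t g x * P t g x \<partial>\<pi>)"
    by (simp add: power2_eq_square)
  also have "\<dots> = (\<integral>x. P t (P t g) x * g x \<partial>\<pi>)"
    using rev t gL PL(1) by (simp add: reversible_def)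
  also have "\<dots> = (\<integral>x. g x * P (2 * t) g x \<partial>\<pi>)"
    using P_add[OF g C t t]
    by (intro Bochner_Integration.integral_cong) (auto simp: space_\<pi>)
  finally have sq: "(\<integral>x. (P t g x)\<^sup>2 \<partial>\<pi>) = (\<integral>x. g x * P (2 * t) g x \<partial>\<pi>)" .
  have "(\<integral>x. (g x - m) * (P (2 * t) g x - c) \<partial>\<pi>)
      = (\<integral>x. g x * P (2 * t) g x - c * g x - m * P (2 * t) g x + m * c \<partial>\<pi>)"
    by (intro Bochner_Integration.integral_cong) (auto simp: algebra_simps)
  also have "\<dots> = (\<integral>x. g x * P (2 * t) g x \<partial>\<pi>) - c * m - m * m + m * c"
    using integral_P[OF g C, of "2 * t"] t by (simp add: prob_space m_def)
  also have "\<dots> = Var \<pi> (P t g)"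
    unfolding Var_eq[OF prob_space_\<pi> PL(1)] sq
    using integral_P[OF g C t] by (simp add: m_def power2_eq_square)
  finally show ?thesis by (simp add: m_def)
qed

lemma Var_P_log_convex:
  assumes rev: "reversible Pr X \<pi>" and t: "0 \<le> t"
    and g: "g \<in> borel_measurable (borel_on E)" and C: "\<And>x. x \<in> E \<Longrightarrow> \<bar>g x\<bar> \<le> C"
  shows "(Var \<pi> (P t g))\<^sup>2 \<le> Var \<pi> g * Var \<pi> (P (2 * t) g)"
proof -
  have gL: "g \<in> L2 \<pi>"
    by (rule L2_of_bounded[OF finite_measure_axioms]) (use g C in \<open>auto simp: measurable_\<pi> space_\<pi>\<close>)
  have cL: "(\<lambda>_. c) \<in> L2 \<pi>" for c
    by (rule L2_of_bounded[OF finite_measure_axioms, where C="\<bar>c\<bar>"]) auto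
  have "P (2 * t) g \<in> L2 \<pi>" using P_L2[OF gL] t by auto
  note CS = L2_Cauchy_Schwarz[OF L2_diff[OF gL cL] L2_diff[OF this cL]]
  let ?m = "\<integral>y. g y \<partial>\<pi>"
  have cov: "Var \<pi> (P t g) = (\<integral>x. (g x - ?m) * (P (2 * t) g x - ?m) \<partial>\<pi>)"
    by (rule Var_P_covariance[OF rev t g C])
  show ?thesis
    unfolding cov using CS[of ?m ?m] integral_P[OF g C, of "2 * t"] t by (simp add: Var_def)
qed

text \<open>
  The first moment of \<open>\<pi>\<close> gives the decay with a constant depending on \<open>g\<close>.  A pointwise bound on the
  centred \<open>P t g\<close> itself would require a second moment; bounding one factor of the covariance by
  \<open>2 * C\<close> avoids it.  Log-convexity then replaces the constant by the variance of \<open>g\<close>.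
\<close>

lemma Var_P_Lip1:
  assumes contr: "contracts_Lip1 E Pr X r" and r: "0 < r" and rev: "reversible Pr X \<pi>"
    and g: "g \<in> Lip1 E" and C: "\<And>x. x \<in> E \<Longrightarrow> \<bar>g x\<bar> \<le> C" and t: "0 \<le> t"
  shows "Var \<pi> (P t g) \<le> exp (- (2 * r) * t) * Var \<pi> g"
proof -
  have gm: "g \<in> borel_measurable (borel_on E)" by (rule Lip1_measurable[OF g])
  obtain x0 where x0: "x0 \<in> E" using not_empty by (auto simp: space_\<pi>)
  define m where "m = (\<integral>x. g x \<partial>\<pi>)"
  have int: "integrable \<pi> g"
    by (rule integrable_of_bounded[where C=C]) (use gm C in \<open>auto simp: measurable_\<pi> space_\<pi>\<close>)
  have mC: "\<bar>m\<bar> \<le> C"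
  proof -
    have "\<bar>m\<bar> \<le> (\<integral>x. \<bar>g x\<bar> \<partial>\<pi>)" unfolding m_def by (rule integral_abs_bound)
    also have "\<dots> \<le> (\<integral>x. C \<partial>\<pi>)" using int C by (intro integral_mono) (auto simp: space_\<pi>)
    finally show ?thesis by (simp add: prob_space)
  qed
  note M = first_moment[OF contr r x0]
  have decay: "Var \<pi> (P s g) \<le> (2 * C * (\<integral>x. \<bar>x - x0\<bar> \<partial>\<pi>)) * exp (- (2 * r) * s)" if s: "0 \<le> s" for s
  proof -
    have s2: "0 \<le> 2 * s" using s by simp
    let ?F = "\<lambda>x. (g x - m) * (P (2 * s) g x - P (2 * s) g x0)"
    have bound: "\<bar>?F x\<bar> \<le> 2 * C * exp (- (2 * r) * s) * \<bar>x - x0\<bar>" if x: "x \<in> E" for x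
    proof -
      have "\<bar>g x - m\<bar> \<le> 2 * C" using C[OF x] mC by linarith
      then have "\<bar>?F x\<bar> \<le> 2 * C * (exp (- r * (2 * s)) * \<bar>x - x0\<bar>)"
        unfolding abs_mult
        using contracts_Lip1D(2)[OF contr g s2 x x0] by (intro mult_mono) auto
      then show ?thesis by (simp add: algebra_simps)
    qed
    have "Var \<pi> (P s g) = (\<integral>x. ?F x \<partial>\<pi>)"
      unfolding m_def by (rule Var_P_covariance[OF rev s gm C])
    also have "\<dots> \<le> (\<integral>x. 2 * C * exp (- (2 * r) * s) * \<bar>x - x0\<bar> \<partial>\<pi>)"
    proof (rule integral_mono_AE)
      have "P (2 * s) g \<in> borel_measurable (borel_on E)" by (rule P_measurable[OF gm s2])
      then have [measurable]: "P (2 * s) g \<in> borel_measurable \<pi>" "g \<in> borel_measurable \<pi>"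
        using gm by (simp_all add: measurable_\<pi>)
      show "integrable \<pi> (\<lambda>x. 2 * C * exp (- (2 * r) * s) * \<bar>x - x0\<bar>)"
        using M by simp
      then show "integrable \<pi> ?F"
      proof (rule Bochner_Integration.integrable_bound)
        show "AE x in \<pi>. norm (?F x) \<le> norm (2 * C * exp (- (2 * r) * s) * \<bar>x - x0\<bar>)"
          unfolding real_norm_def
          by (intro AE_I2 order_trans[OF bound abs_ge_self]) (simp add: space_\<pi>)
      qed measurable
      show "AE x in \<pi>. ?F x \<le> 2 * C * exp (- (2 * r) * s) * \<bar>x - x0\<bar>"
        by (intro AE_I2 order_trans[OF abs_ge_self bound]) (simp add: space_\<pi>)
    qed
    finally show ?thesis by (simp add: algebra_simps)
  qed
  have convex: "(Var \<pi> (P s g))\<^sup>2 \<le> Var \<pi> g * Var \<pi> (P (2 * s) g)" if "0 \<le> s" for s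
    by (rule Var_P_log_convex[OF rev that gm C])
  show ?thesis
    by (rule exp_decay_self_improvement[where v="\<lambda>t. Var \<pi> (P t g)", OF _ decay convex _ t]) simp_all
qed

text \<open>
  The variance bound is for functions bounded at every point of \<open>E\<close>, whereas
  \<open>Linf\<close> bounds \<open>g\<close> almost everywhere only.  Clamping \<open>g\<close> to the interval \<open>[-C, C]\<close> changes it on a
  null set and does not increase its Lipschitz constant.
\<close>

lemma bounded_Lip1_dense:
  assumes dense: "L2_dense \<pi> {\<lambda>x. c * g x |c g. g \<in> Lip1 E \<inter> Linf \<pi> \<inter> L2 \<pi>}"
    and f: "f \<in> L2 \<pi>" and e: "0 < e"
  obtains c g C where "g \<in> Lip1 E" "\<And>x. x \<in> E \<Longrightarrow> \<bar>g x\<bar> \<le> C" "L2_norm \<pi> (\<lambda>x. f x - c * g x) < e"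
proof -
  obtain k where k: "k \<in> {\<lambda>x. c * g x |c g. g \<in> Lip1 E \<inter> Linf \<pi> \<inter> L2 \<pi>}"
    and "L2_norm \<pi> (\<lambda>x. f x - k x) < e"
    using dense[unfolded L2_dense_def, rule_format, OF f e] by (elim bexE)
  moreover from k obtain c g where g: "g \<in> Lip1 E" "g \<in> Linf \<pi>" and "k = (\<lambda>x. c * g x)"
    by (elim CollectE exE conjE IntE)
  ultimately have le: "L2_norm \<pi> (\<lambda>x. f x - c * g x) < e" by simp
  from g(2) obtain C0 where "AE x in \<pi>. \<bar>g x\<bar> \<le> C0" by (auto simp: Linf_def)
  then have AE: "AE x in \<pi>. \<bar>g x\<bar> \<le> \<bar>C0\<bar>" by eventually_elim linarith
  define C where "C = \<bar>C0\<bar>"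
  define h where "h x = max (- C) (min C (g x))" for x
  have h: "h \<in> Lip1 E" unfolding h_def[abs_def] by (rule Lip1_clamp[OF g(1)])
  have hC: "\<bar>h x\<bar> \<le> C" for x by (auto simp: h_def C_def)
  have [measurable]: "f \<in> borel_measurable \<pi>" "g \<in> borel_measurable \<pi>" "h \<in> borel_measurable \<pi>"
    using f g(1) h by (auto simp: L2_def measurable_\<pi> Lip1_measurable)
  have "AE x in \<pi>. h x = g x" using AE by eventually_elim (auto simp: h_def C_def)
  then have "L2_norm \<pi> (\<lambda>x. f x - c * h x) = L2_norm \<pi> (\<lambda>x. f x - c * g x)"
    unfolding L2_norm_def by (intro arg_cong[where f=sqrt] integral_cong_AE) auto
  with le show thesis by (intro that[OF h hC, of c]) simp
qed

text \<open>
  Approximate \<open>f\<close> by a multiple of a bounded Lipschitz function.  Both sides of the inequality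
  between standard deviations change by at most the distance in \<open>L\<^sup>2\<close>, as \<open>P t\<close> is a contraction.
\<close>

lemma Var_P_L2:
  assumes contr: "contracts_Lip1 E Pr X r" and r: "0 < r" and rev: "reversible Pr X \<pi>"
    and dense: "L2_dense \<pi> {\<lambda>x. c * g x |c g. g \<in> Lip1 E \<inter> Linf \<pi> \<inter> L2 \<pi>}"
    and f: "f \<in> L2 \<pi>" and t: "0 \<le> t"
  shows "Var \<pi> (P t f) \<le> exp (- 2 * r * t) * Var \<pi> f"
proof -
  have "sqrt (Var \<pi> (P t f)) \<le> exp (- r * t) * sqrt (Var \<pi> f)"
  proof (rule field_le_epsilon)
    fix e :: real assume e: "0 < e"
    from e have "0 < e / 2" by simp
    then obtain c g C where g: "g \<in> Lip1 E" and C: "\<And>x. x \<in> E \<Longrightarrow> \<bar>g x\<bar> \<le> C"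
      and le: "L2_norm \<pi> (\<lambda>x. f x - c * g x) < e / 2"
      by (rule bounded_Lip1_dense[OF dense f]) (rule that)
    define h where "h = (\<lambda>x. c * g x)"
    have gL: "g \<in> L2 \<pi>"
      by (rule L2_of_bounded[OF finite_measure_axioms])
         (use Lip1_measurable[OF g] C in \<open>auto simp: measurable_\<pi> space_\<pi>\<close>)
    then have hL: "h \<in> L2 \<pi>" unfolding h_def by (rule L2_cmult)
    have Ph: "P t (\<lambda>x. c * g x) = (\<lambda>x. c * P t g x)" by (simp add: semigroup_of_def fun_eq_iff)
    have "Var \<pi> (P t h) \<le> exp (- (2 * r) * t) * Var \<pi> h"
      using mult_left_mono[OF Var_P_Lip1[OF contr r rev g C t], of "c\<^sup>2"]
      unfolding h_def Ph Var_cmult by (simp add: algebra_simps)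
    also have "exp (- (2 * r) * t) = (exp (- r * t))\<^sup>2"
      by (simp add: power2_eq_square flip: exp_add)
    finally have decay: "sqrt (Var \<pi> (P t h)) \<le> exp (- r * t) * sqrt (Var \<pi> h)"
      using real_sqrt_le_mono by (fastforce simp: real_sqrt_mult)
    have "sqrt (Var \<pi> (P t f)) \<le> sqrt (Var \<pi> (P t h)) + L2_norm \<pi> (\<lambda>x. P t f x - P t h x)"
      by (rule sqrt_Var_le[OF prob_space_\<pi> P_L2[OF f t] P_L2[OF hL t]])
    also have "\<dots> \<le> exp (- r * t) * sqrt (Var \<pi> h) + e / 2"
      using decay P_L2_diff[OF f hL t] le by (simp add: h_def)
    also have "sqrt (Var \<pi> h) \<le> sqrt (Var \<pi> f) + e / 2"
    proof -
      have "L2_norm \<pi> (\<lambda>x. h x - f x) = L2_norm \<pi> (\<lambda>x. f x - h x)"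
        by (simp add: L2_norm_def power2_commute)
      then show ?thesis
        using sqrt_Var_le[OF prob_space_\<pi> hL f] le by (simp add: h_def)
    qed
    then have "exp (- r * t) * sqrt (Var \<pi> h) \<le> exp (- r * t) * sqrt (Var \<pi> f) + exp (- r * t) * (e / 2)"
      unfolding distrib_left[symmetric] by (intro mult_left_mono) auto
    moreover have "exp (- r * t) * (e / 2) \<le> 1 * (e / 2)"
      using r t e by (intro mult_right_mono) auto
    ultimately show "sqrt (Var \<pi> (P t f)) \<le> exp (- r * t) * sqrt (Var \<pi> f) + e"
      by simp
  qed
  from power_mono[OF this, of 2] show ?thesis
    by (simp add: power_mult_distrib exp_double[symmetric] mult.assoc)
qed

end

end

theorem theorem1p1:
  fixes E :: "real set" and \<Omega> :: "'w measure"
    and Pr :: "real \<Rightarrow> 'w measure" and X :: "real \<Rightarrow> 'w \<Rightarrow> real"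
    and \<pi> :: "real measure" and \<rho> :: real
  assumes process: "markov_process E \<Omega> Pr X"
    and invariant: "invariant_distribution E Pr X \<pi>"
    and curvature: "is_wasserstein_curvature E Pr X \<rho>" and positive: "\<rho> > 0"
    and reversible: "reversible Pr X \<pi>"
    and continuous: "\<And>f. f \<in> L2 \<pi> \<Longrightarrow>
      ((\<lambda>t. L2_norm \<pi> (\<lambda>x. semigroup_of Pr X t f x - f x)) \<longlongrightarrow> 0) (at_right 0)"
    and dense: "L2_dense \<pi> {\<lambda>x. c * g x |c g. g \<in> Lip1 E \<inter> Linf \<pi> \<inter> L2 \<pi>}"
  shows "invariant_distribution E Pr X \<pi> \<and>
    (\<forall>f\<in>L2 \<pi>. \<forall>t\<ge>0.
      semigroup_of Pr X t f \<in> L2 \<pi> \<and>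
      Var \<pi> (semigroup_of Pr X t f) \<le> exp (- 2 * \<rho> * t) * Var \<pi> f)"
proof -
  interpret markov_process E \<Omega> Pr X by (rule process)
  have "contracts_Lip1 E Pr X \<rho>" using curvature by (simp add: is_wasserstein_curvature_def)
  then show ?thesis
    using invariant P_L2[OF invariant] Var_P_L2[OF invariant _ positive reversible dense] by blast
qed

end
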